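(* Let $\beta>0$ be fixed. For each $n$, let $F\in\mathbb{R}^{n\times m}$ (with $m=m(n)$), let $\gamma(n)\in(0,1)$ be such that $k^*=\gamma(n)n$ is an integer, let $\alpha_{k^*}\in[0,1]$, and suppose that $$\left(\sqrt{2k^*\log\frac{2n}{k^*}}+\beta\right)\sigma_{k^*}(F)\leq\left(\sqrt{\frac{2}{\pi}}\sum_{i=1}^n\|F_i\|_2-\beta L(F)\right)\alpha_{k^*}.$$ Then, for $n$ sufficiently large and every integer $k\ge 1$ with $k\leq\gamma(n)(\log n)^{-1}k^*$, $$\left(\sqrt{2k\log\frac{2n}{k}}+\beta\right)\left(SDP_k(M)\right)^{1/2}\leq\left(\sqrt{\frac{2}{\pi}}\sum_{i=1}^n\|F_i\|_2-\beta L(F)\right)\alpha_{k^*},$$ where $$M=\begin{pmatrix}1&-1\\-1&1\end{pmatrix}\otimes FF^T\in\mathbb{R}^{2n\times 2n}.$$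
   Context: $F_i$ denotes the $i$-th row of $F$, $\mathbf{1}$ the all-ones vector, $\otimes$ the Kronecker product. For an integer $1\le j\le n$, $\sigma_j(F)\ge 0$ is defined by $$\sigma_j^2(F)=\max_{u\in\{0,1\}^{2n},\ \mathbf{1}^Tu\leq j}u^T\left(\begin{pmatrix}1&-1\\-1&1\end{pmatrix}\otimes FF^T\right)u,$$ and $L(F)\ge 0$ by $L^2(F)=\max_{v\in\{-1,1\}^n}v^TFF^Tv$. For a symmetric positive semidefinite matrix $M\in\mathbb{R}^{N\times N}$, $SDP_k(M)$ is the optimal value of the semidefinite program: maximize $\operatorname{Tr}(MX)$ over symmetric $X\in\mathbb{R}^{N\times N}$ subject to $0\leq X_{ij}\leq 1$ for all $i,j$, $\operatorname{Tr}X=k$, and $X\succeq 0$ (here $N=2n$). *)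

theory Defs
  imports Complex_Main "Jordan_Normal_Form.Matrix"
begin

text \<open>Matrices and vectors are those of Jordan_Normal_Form: the dimensions are part of the object
  (so they may vary with a sequence index) and indices start at \<open>0\<close>.\<close>

definition kronecker :: "real mat \<Rightarrow> real mat \<Rightarrow> real mat" where
  "kronecker A B = mat (dim_row A * dim_row B) (dim_col A * dim_col B)
     (\<lambda>(i, j). A $$ (i div dim_row B, j div dim_col B) * B $$ (i mod dim_row B, j mod dim_col B))"

definition lifted_gram :: "real mat \<Rightarrow> real mat" where
  "lifted_gram F = kronecker (mat_of_rows_list 2 [[1, -1], [-1, 1]]) (F * transpose_mat F)"

definition row_norm :: "real mat \<Rightarrow> nat \<Rightarrow> real" where
  "row_norm F i = sqrt (row F i \<bullet> row F i)"

text \<open>The two maxima below range over finite nonempty sets, and are nonnegative because the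
  quadratic forms are positive semidefinite; so \<open>sqrt\<close> is the nonnegative root.\<close>

definition sigma_sparse :: "nat \<Rightarrow> real mat \<Rightarrow> real" where
  "sigma_sparse j F = sqrt (Max {u \<bullet> (lifted_gram F *\<^sub>v u) | u.
     u \<in> carrier_vec (2 * dim_row F) \<and>
     (\<forall>i < 2 * dim_row F. u $ i \<in> {0, 1}) \<and>
     (\<Sum>i < 2 * dim_row F. u $ i) \<le> real j})"

definition L_sign :: "real mat \<Rightarrow> real" where
  "L_sign F = sqrt (Max {v \<bullet> (F * transpose_mat F *\<^sub>v v) | v.
     v \<in> carrier_vec (dim_row F) \<and> (\<forall>i < dim_row F. v $ i \<in> {-1, 1})})"

definition pos_semidef :: "real mat \<Rightarrow> bool" where
  "pos_semidef X \<longleftrightarrow> square_mat X \<and> transpose_mat X = X \<and>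
     (\<forall>v \<in> carrier_vec (dim_row X). v \<bullet> (X *\<^sub>v v) \<ge> 0)"

definition mat_trace :: "real mat \<Rightarrow> real" where
  "mat_trace X = (\<Sum>i < dim_row X. X $$ (i, i))"

definition sdp_feasible :: "nat \<Rightarrow> nat \<Rightarrow> real mat set" where
  "sdp_feasible N k = {X \<in> carrier_mat N N.
     (\<forall>i < N. \<forall>j < N. 0 \<le> X $$ (i, j) \<and> X $$ (i, j) \<le> 1) \<and>
     mat_trace X = real k \<and> pos_semidef X}"

text \<open>The objective is bounded on the feasible set (entries lie in \<open>[0, 1]\<close>), which is nonempty
  exactly for \<open>k \<le> N\<close>; outside that range the real supremum carries no meaning.\<close>

definition SDP :: "nat \<Rightarrow> real mat \<Rightarrow> real" where
  "SDP k M = (SUP X \<in> sdp_feasible (dim_row M) k. mat_trace (M * X))"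

end

theory Submission
  imports Defs
begin

text \<open>A truncation argument gives the little Grothendieck inequality: for positive semidefinite
  \<open>A\<close> and \<open>X\<close>, the trace of \<open>A X\<close> is at most four times the maximum of the quadratic form of \<open>A\<close>
  over the box \<open>\<bar>z\<^sub>i\<bar> \<le> sqrt X\<^sub>i\<^sub>i\<close>. If \<open>X\<close> is feasible for the semidefinite program, then
  Cauchy-Schwarz bounds the \<open>l\<^sub>1\<close> norm of such \<open>z\<close> by \<open>sqrt (2 n k) \<le> 2 k*\<close>. Since the form of \<open>M\<close> only
  sees the difference of the two halves of \<open>z\<close>, half of \<open>z\<close> can be replaced by a vector in
  \<open>[0, 1]\<^sup>2\<^sup>n\<close> with entry sum at most \<open>k*\<close>, and a convex function on this polytope is maximal at a
  0-1 vector. Hence \<open>sqrt SDP\<^sub>k \<le> 4 \<sigma>\<^sub>k\<^sub>*\<close>. The constant 4 is absorbed by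
  \<open>k ln (2n/k) \<le> 2 sqrt (2nk) = O(k* / sqrt (ln n))\<close>, while \<open>k* \<ge> ln n\<close> absorbs \<open>\<beta>\<close>.\<close>

section \<open>Quadratic forms in coordinates and Gram factorisation\<close>

text \<open>Forms and vectors are plain functions of which only the indices below \<open>n\<close>
  are read; this suits induction on \<open>n\<close> and changes of single coordinates.\<close>

definition quad :: "nat \<Rightarrow> (nat \<Rightarrow> nat \<Rightarrow> real) \<Rightarrow> (nat \<Rightarrow> real) \<Rightarrow> real" where
  "quad n A v = (\<Sum>i<n. \<Sum>j<n. A i j * v i * v j)"

definition psd :: "nat \<Rightarrow> (nat \<Rightarrow> nat \<Rightarrow> real) \<Rightarrow> bool" where
  "psd n A \<longleftrightarrow> (\<forall>i<n. \<forall>j<n. A i j = A j i) \<and> (\<forall>v. 0 \<le> quad n A v)"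

lemma quad_add_scaled:
  "quad n A (\<lambda>i. u i + t * d i) =
     quad n A u + t * (\<Sum>i<n. \<Sum>j<n. A i j * (u i * d j + d i * u j)) + t\<^sup>2 * quad n A d"
  unfolding quad_def sum_distrib_left sum.distrib[symmetric]
  by (intro sum.cong refl) (simp add: algebra_simps power2_eq_square)

lemma quad_Suc:
  assumes "\<And>i j. i < Suc n \<Longrightarrow> j < Suc n \<Longrightarrow> A i j = A j i"
  shows "quad (Suc n) A v = quad n A v + 2 * v n * (\<Sum>i<n. A i n * v i) + A n n * (v n)\<^sup>2"
proof -
  have "(\<Sum>j<n. A n j * v n * v j) = v n * (\<Sum>i<n. A i n * v i)"
    unfolding sum_distrib_left by (intro sum.cong refl) (auto simp: assms[of n])
  moreover have "(\<Sum>i<n. A i n * v i * v n) = v n * (\<Sum>i<n. A i n * v i)"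
    unfolding sum_distrib_left by (intro sum.cong refl) auto
  ultimately show ?thesis
    unfolding quad_def by (simp add: sum.distrib power2_eq_square algebra_simps)
qed

text \<open>Parallelogram law with the nonnegative value at \<open>u - d\<close> dropped.\<close>

lemma psd_add_le:
  assumes "psd n A"
  shows "quad n A (\<lambda>i. u i + d i) \<le> 2 * quad n A u + 2 * quad n A d"
proof -
  have "0 \<le> quad n A (\<lambda>i. u i + (-1) * d i)"
    using assms unfolding psd_def by blast
  then show ?thesis
    using quad_add_scaled[of n A u "-1" d] quad_add_scaled[of n A u 1 d] by simp
qed

lemma quad_two_points:
  assumes "i < n" "j < n" "i \<noteq> j"
  shows "quad n A (\<lambda>l. if l = i then x else if l = j then y else 0) =
    A i i * x\<^sup>2 + A i j * x * y + A j i * x * y + A j j * y\<^sup>2"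
proof -
  let ?v = "\<lambda>l. if l = i then x else if l = j then y else (0::real)"
  have *: "(\<Sum>l<n. f l * ?v l) = f i * x + f j * y" for f
  proof -
    have "(\<Sum>l<n. f l * ?v l) = (\<Sum>l\<in>{i, j}. f l * ?v l)"
      by (intro sum.mono_neutral_right) (use assms in auto)
    then show ?thesis using assms by auto
  qed
  have "quad n A ?v = (\<Sum>l<n. (\<Sum>l'<n. A l l' * ?v l') * ?v l)"
    unfolding quad_def sum_distrib_right by (intro sum.cong refl) (simp only: mult_ac)
  also have "\<dots> = (A i i * x + A i j * y) * x + (A j i * x + A j j * y) * y"
    unfolding * ..
  finally show ?thesis by (simp add: power2_eq_square algebra_simps)
qed

lemma psd_diag_nonneg:
  assumes "psd n A" "i < n"
  shows "0 \<le> A i i"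
proof -
  have "quad n A (\<lambda>l. if l = i then 1 else 0) = (\<Sum>l<n. if l = i then A i i else 0)"
    unfolding quad_def using assms(2) by (intro sum.cong refl) (simp add: if_distrib cong: if_cong)
  also have "\<dots> = A i i" using assms(2) by simp
  finally show ?thesis using assms(1) unfolding psd_def by metis
qed

text \<open>On vectors with i-th entry 1, j-th entry \<open>y\<close> and zeros elsewhere the form
  is affine in \<open>y\<close>, so a nonzero slope would make it negative somewhere.\<close>

lemma psd_zero_diag:
  assumes "psd n A" "i < n" "j < n" "A j j = 0"
  shows "A i j = 0"
proof (rule ccontr)
  assume nz: "A i j \<noteq> 0"
  then have "i \<noteq> j" using assms(4) by auto
  \<comment> \<open>This \<open>y\<close> gives the form the value -1.\<close>
  define y where "y = - (A i i + 1) / (2 * A i j)"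
  have "A j i = A i j" using assms unfolding psd_def by auto
  then have "0 \<le> A i i + 2 * A i j * y"
    using assms(1) quad_two_points[OF assms(2,3) \<open>i \<noteq> j\<close>, of A 1 y] assms(4)
    unfolding psd_def by (metis (no_types, lifting) add.assoc add.right_neutral mult.assoc
      mult.right_neutral mult_2 mult_zero_left one_power2)
  moreover have "2 * A i j * y = - (A i i + 1)" using nz unfolding y_def by simp
  ultimately show False by simp
qed

text \<open>Cholesky factorisation by induction on the dimension: a factor of the Schur complement
  of the last diagonal entry is extended by one column built from the last column of
  \<open>Y\<close>.\<close>

lemma psd_gram:
  assumes "psd n Y"
  shows "\<exists>G. \<forall>i<n. \<forall>j<n. Y i j = (\<Sum>l<n. G i l * G j l)"
  using assms
proof (induction n arbitrary: Y)
  case 0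
  then show ?case by simp
next
  case (Suc n)
  define p where "p = Y n n"
  have p0: "p \<ge> 0" using psd_diag_nonneg[OF Suc.prems, of n] by (simp add: p_def)
  have sym: "\<And>i j. i < Suc n \<Longrightarrow> j < Suc n \<Longrightarrow> Y i j = Y j i"
    using Suc.prems unfolding psd_def by blast
  \<comment> \<open>Schur complement; for \<open>p = 0\<close> the column vanishes and division by zero yields \<open>Y\<close> itself.\<close>
  define Y' where "Y' i j = Y i j - Y i n * Y j n / p" for i j
  have "psd n Y'"
    unfolding psd_def
  proof (intro conjI allI impI)
    fix i j assume "i < n" "j < n"
    then show "Y' i j = Y' j i" using sym[of i j] by (simp add: Y'_def)
  next
    fix v
    define b where "b = (\<Sum>i<n. Y i n * v i)"
    \<comment> \<open>For \<open>p > 0\<close> this last coordinate minimises the form of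
      \<open>Y\<close>, and the minimum is the form of the Schur complement at
      \<open>v\<close>.\<close>
    define v' where "v' = v(n := - b / p)"
    have "quad n Y' v = quad n Y v - (\<Sum>i<n. \<Sum>j<n. (Y i n * v i) * (Y j n * v j) / p)"
      unfolding quad_def Y'_def sum_subtractf[symmetric]
      by (intro sum.cong refl) (simp add: algebra_simps)
    also have "(\<Sum>i<n. \<Sum>j<n. (Y i n * v i) * (Y j n * v j) / p) = b * b / p"
      unfolding b_def sum_product sum_divide_distrib ..
    also have "quad n Y v - b * b / p = quad (Suc n) Y v'"
    proof -
      have "quad n Y v' = quad n Y v" "(\<Sum>i<n. Y i n * v' i) = b"
        unfolding quad_def b_def v'_def by (auto intro!: sum.cong)
      moreover have "v' n = - b / p" by (simp add: v'_def)
      ultimately show ?thesis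
        using quad_Suc[OF sym, where v = v'] by (cases "p = 0")
          (auto simp: p_def[symmetric] power2_eq_square field_simps)
    qed
    finally show "0 \<le> quad n Y' v" using Suc.prems unfolding psd_def by simp
  qed
  then obtain G where G: "\<And>i j. i < n \<Longrightarrow> j < n \<Longrightarrow> Y' i j = (\<Sum>l<n. G i l * G j l)"
    using Suc.IH by blast
  define G' where "G' i l = (if l = n then Y i n / sqrt p else if i < n then G i l else 0)" for i l
  have "Y i j = (\<Sum>l<Suc n. G' i l * G' j l)" if "i < Suc n" "j < Suc n" for i j
  proof -
    have "(\<Sum>l<n. G' i l * G' j l) = (if i < n \<and> j < n then Y' i j else 0)"
      using that G by (auto simp: G'_def)
    moreover have "G' i n * G' j n = Y i n * Y j n / p" using p0 by (simp add: G'_def)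
    moreover have "Y i n * Y j n / p = Y i j" if "i = n \<or> j = n"
    proof (cases "p = 0")
      case True
      then have "Y i j = 0" using that psd_zero_diag[OF Suc.prems] sym
          \<open>i < Suc n\<close> \<open>j < Suc n\<close> p_def by (metis lessI)
      then show ?thesis using True by simp
    next
      case False
      then show ?thesis using that sym[of n j] \<open>j < Suc n\<close> by (auto simp: p_def)
    qed
    ultimately show ?thesis using that by (auto simp: Y'_def less_Suc_eq)
  qed
  then show ?case by blast
qed

section \<open>A little Grothendieck inequality\<close>

text \<open>A sign pattern is encoded by the set \<open>T\<close> of its positive positions; the
  expectation over \<open>d\<close> independent signs is the sum over \<open>Pow {..<d}\<close>
  divided by \<open>2 ^ d\<close>.\<close>

definition rademacher :: "nat set \<Rightarrow> nat \<Rightarrow> real" where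
  "rademacher T l = (if l \<in> T then 1 else -1)"

lemma sum_Pow_Suc:
  fixes f :: "nat set \<Rightarrow> real"
  shows "(\<Sum>T\<in>Pow {..<Suc d}. f T) = (\<Sum>T\<in>Pow {..<d}. f T + f (insert d T))"
proof -
  have "inj_on (insert d) (Pow {..<d})"
    by (rule inj_onI) (metis PowD insert_ident lessThan_iff less_irrefl subsetD)
  moreover have "Pow {..<d} \<inter> insert d ` Pow {..<d} = {}" by auto
  ultimately show ?thesis
    unfolding lessThan_Suc Pow_insert
    by (simp add: sum.union_disjoint sum.reindex sum.distrib)
qed

lemma rademacher_sum_Suc:
  assumes "T \<in> Pow {..<d}"
  shows "(\<Sum>l<Suc d. a l * rademacher T l) = (\<Sum>l<d. a l * rademacher T l) - a d"
    and "(\<Sum>l<Suc d. a l * rademacher (insert d T) l) = (\<Sum>l<d. a l * rademacher T l) + a d"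
proof -
  have "d \<notin> T" using assms by auto
  then show "(\<Sum>l<Suc d. a l * rademacher T l) = (\<Sum>l<d. a l * rademacher T l) - a d"
    by (simp add: rademacher_def)
  have "(\<Sum>l<d. a l * rademacher (insert d T) l) = (\<Sum>l<d. a l * rademacher T l)"
    by (intro sum.cong refl) (auto simp: rademacher_def)
  then show "(\<Sum>l<Suc d. a l * rademacher (insert d T) l) = (\<Sum>l<d. a l * rademacher T l) + a d"
    by (simp add: rademacher_def)
qed

text \<open>The signs are orthonormal: in the induction step the terms linear in the new sign cancel
  between its two values.\<close>

lemma rademacher_second_moment:
  "(\<Sum>T\<in>Pow {..<d}. (\<Sum>l<d. a l * rademacher T l) * (\<Sum>l<d. b l * rademacher T l)) =
     2 ^ d * (\<Sum>l<d. a l * b l)"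
proof (induction d)
  case (Suc d)
  let ?X = "\<lambda>a T. \<Sum>l<d. a l * rademacher T l"
  have "(\<Sum>T\<in>Pow {..<Suc d}. (\<Sum>l<Suc d. a l * rademacher T l) * (\<Sum>l<Suc d. b l * rademacher T l))
     = (\<Sum>T\<in>Pow {..<d}. 2 * (?X a T * ?X b T) + 2 * (a d * b d))"
    unfolding sum_Pow_Suc
    by (intro sum.cong refl) (simp only: rademacher_sum_Suc, simp add: algebra_simps)
  also have "\<dots> = 2 * (2 ^ d * (\<Sum>l<d. a l * b l)) + 2 ^ d * (2 * (a d * b d))"
    unfolding sum.distrib sum_distrib_left[symmetric] Suc.IH by (simp add: card_Pow)
  finally show ?case by (simp add: algebra_simps)
qed simp

text \<open>Khintchine's inequality for the fourth moment. The odd powers cancel when the last sign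
  is averaged, and the mixed term is a second moment.\<close>

lemma rademacher_fourth_moment:
  "(\<Sum>T\<in>Pow {..<d}. (\<Sum>l<d. a l * rademacher T l) ^ 4) \<le> 2 ^ d * (3 * (\<Sum>l<d. (a l)\<^sup>2)\<^sup>2)"
proof (induction d)
  case (Suc d)
  let ?X = "\<lambda>T. \<Sum>l<d. a l * rademacher T l"
  let ?s = "\<Sum>l<d. (a l)\<^sup>2"
  have "(\<Sum>T\<in>Pow {..<Suc d}. (\<Sum>l<Suc d. a l * rademacher T l) ^ 4)
     = (\<Sum>T\<in>Pow {..<d}. 2 * ?X T ^ 4 + 12 * (a d)\<^sup>2 * (?X T * ?X T) + 2 * a d ^ 4)"
    unfolding sum_Pow_Suc
    by (intro sum.cong refl) (simp only: rademacher_sum_Suc,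
      simp add: power4_eq_xxxx power2_eq_square algebra_simps)
  also have "\<dots> = 2 * (\<Sum>T\<in>Pow {..<d}. ?X T ^ 4) + 12 * (a d)\<^sup>2 * (2 ^ d * ?s) + 2 ^ d * (2 * a d ^ 4)"
    unfolding sum.distrib sum_distrib_left[symmetric] rademacher_second_moment
    by (simp add: card_Pow power2_eq_square)
  \<comment> \<open>Enlarging the coefficient of \<open>a d ^ 4\<close> from 2 to 6 completes the
    square.\<close>
  also have "\<dots> \<le> 2 * (2 ^ d * (3 * ?s\<^sup>2)) + 12 * (a d)\<^sup>2 * (2 ^ d * ?s) + 2 ^ d * (6 * a d ^ 4)"
    using Suc.IH by (intro add_mono mult_left_mono) auto
  also have "\<dots> = 2 ^ Suc d * (3 * (\<Sum>l<Suc d. (a l)\<^sup>2)\<^sup>2)"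
    by (simp add: power4_eq_xxxx power2_eq_square algebra_simps)
  finally show ?case .
qed simp

definition clip :: "real \<Rightarrow> real \<Rightarrow> real" where
  "clip s x = max (- s) (min s x)"

text \<open>The first bound lets the fourth moment control the variance of the remainder; the second
  one serves the case \<open>s = 0\<close>, where the first is void.\<close>

lemma clip_remainder:
  assumes "s \<ge> 0"
  shows "s\<^sup>2 * (x - clip s x)\<^sup>2 \<le> x ^ 4 / 16"
    and "(x - clip s x)\<^sup>2 \<le> x\<^sup>2"
    and "\<bar>clip s x\<bar> \<le> s"
proof -
  \<comment> \<open>AM-GM: \<open>s * (\<bar>x\<bar> - s) \<le> x\<^sup>2 / 4\<close>\<close>
  have "s * \<bar>x - clip s x\<bar> \<le> x\<^sup>2 / 4"
  proof -
    have "0 \<le> (\<bar>x\<bar> - 2 * s)\<^sup>2" by simp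
    then have "s * (\<bar>x\<bar> - s) \<le> x\<^sup>2 / 4"
      unfolding power2_diff by (simp add: power2_eq_square algebra_simps)
    moreover have "\<bar>x - clip s x\<bar> = (if \<bar>x\<bar> \<le> s then 0 else \<bar>x\<bar> - s)"
      using assms by (auto simp: clip_def)
    ultimately show ?thesis by auto
  qed
  then have "(s * \<bar>x - clip s x\<bar>)\<^sup>2 \<le> (x\<^sup>2 / 4)\<^sup>2"
    using assms by (intro power_mono) auto
  then show "s\<^sup>2 * (x - clip s x)\<^sup>2 \<le> x ^ 4 / 16"
    by (simp add: power_mult_distrib power_divide flip: power_mult)
  have "\<bar>x - clip s x\<bar> \<le> \<bar>x\<bar>" using assms by (auto simp: clip_def)
  then show "(x - clip s x)\<^sup>2 \<le> x\<^sup>2" by (simp add: abs_le_square_iff)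
  show "\<bar>clip s x\<bar> \<le> s" using assms by (auto simp: clip_def)
qed

section \<open>Covariances, trace pairing and the truncation argument\<close>

lemma psd_sum_outer:
  assumes "finite I"
  shows "psd n (\<lambda>i j. \<Sum>t\<in>I. r t i * r t j)"
  unfolding psd_def
proof (intro conjI allI impI)
  show "(\<Sum>t\<in>I. r t i * r t j) = (\<Sum>t\<in>I. r t j * r t i)" for i j
    by (simp add: mult.commute)
  fix v
  have "quad n (\<lambda>i j. \<Sum>t\<in>I. r t i * r t j) v = (\<Sum>t\<in>I. quad n (\<lambda>i j. r t i * r t j) v)"
    unfolding quad_def sum_distrib_right sum.swap[of _ I] ..
  also have "\<dots> = (\<Sum>t\<in>I. (\<Sum>i<n. r t i * v i) * (\<Sum>i<n. r t i * v i))"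
    unfolding quad_def sum_product by (simp add: mult_ac)
  also have "\<dots> \<ge> 0" by (intro sum_nonneg) simp
  finally show "0 \<le> quad n (\<lambda>i j. \<Sum>t\<in>I. r t i * r t j) v" .
qed

text \<open>The form is nonnegative at the sum and at the difference of two unit vectors.
  Off-diagonal entries are thus controlled by the diagonal, which keeps the supremum in
  \<open>little_grothendieck\<close> finite.\<close>

lemma psd_entry_le:
  assumes "psd n Y" "i < n" "j < n"
  shows "2 * \<bar>Y i j\<bar> \<le> Y i i + Y j j"
proof (cases "i = j")
  case True
  then show ?thesis using psd_diag_nonneg[OF assms(1,2)] by simp
next
  case False
  have "Y j i = Y i j" using assms unfolding psd_def by auto
  moreover have "0 \<le> Y i i * 1\<^sup>2 + Y i j * 1 * y + Y j i * 1 * y + Y j j * y\<^sup>2" for y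
    using assms(1) unfolding quad_two_points[OF assms(2,3) False, symmetric] psd_def by blast
  from this[of 1] this[of "-1"] have "0 \<le> Y i i + Y i j + Y j i + Y j j"
    "0 \<le> Y i i - Y i j - Y j i + Y j j" by simp_all
  ultimately show ?thesis by (simp add: abs_if)
qed

text \<open>The trace inner product: the trace of \<open>A Y\<close> for symmetric
  \<open>Y\<close>.\<close>

definition pairing :: "nat \<Rightarrow> (nat \<Rightarrow> nat \<Rightarrow> real) \<Rightarrow> (nat \<Rightarrow> nat \<Rightarrow> real) \<Rightarrow> real" where
  "pairing n A Y = (\<Sum>i<n. \<Sum>j<n. A i j * Y i j)"

lemma sum_quad_eq_pairing:
  "(\<Sum>t\<in>I. quad n A (w t)) = pairing n A (\<lambda>i j. \<Sum>t\<in>I. w t i * w t j)"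
  unfolding quad_def pairing_def sum_distrib_left sum.swap[of _ I] by (simp add: mult_ac)

lemma pairing_scale: "pairing n A (\<lambda>i j. c * Y i j) = c * pairing n A Y"
  unfolding pairing_def sum_distrib_left by (simp add: mult_ac)

lemma psd_scale:
  assumes "psd n Y" "c \<ge> 0"
  shows "psd n (\<lambda>i j. c * Y i j)"
proof -
  have "quad n (\<lambda>i j. c * Y i j) v = c * quad n Y v" for v
    unfolding quad_def sum_distrib_left by (simp add: mult_ac)
  then show ?thesis using assms unfolding psd_def by auto
qed

text \<open>Write \<open>Y\<close> as the covariance of a Rademacher sum \<open>w\<close> and truncate \<open>w\<close> at level \<open>s\<close>. The
  truncation is bounded by \<open>V\<close>, and the covariance of the remainder is again admissible after
  multiplication by 4, because of the fourth moment bound.\<close>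

lemma little_grothendieck_step:
  assumes A: "psd n A" and Y: "psd n Y" and s: "\<And>i. i < n \<Longrightarrow> 0 \<le> s i"
    and diag: "\<And>i. i < n \<Longrightarrow> Y i i \<le> (s i)\<^sup>2"
    and V: "\<And>z. (\<And>i. i < n \<Longrightarrow> \<bar>z i\<bar> \<le> s i) \<Longrightarrow> quad n A z \<le> V"
  shows "\<exists>R. psd n R \<and> (\<forall>i<n. R i i \<le> (s i)\<^sup>2) \<and> pairing n A Y \<le> 2 * V + pairing n A R / 2"
proof -
  obtain G where G: "\<And>i j. i < n \<Longrightarrow> j < n \<Longrightarrow> Y i j = (\<Sum>l<n. G i l * G j l)"
    using psd_gram[OF Y] by blast
  define w where "w T i = (\<Sum>l<n. G i l * rademacher T l)" for T i
  define v where "v T i = clip (s i) (w T i)" for T i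
  define r where "r T i = w T i - v T i" for T i
  define I where "I = Pow {..<n}"
  have I: "finite I" "real (card I) = 2 ^ n" by (simp_all add: I_def card_Pow)
  \<comment> \<open>Dividing by \<open>2 ^ n\<close> averages over the signs. The variance of
    \<open>r\<close> at \<open>i\<close> is at most 3/16 of \<open>(s i)\<^sup>2\<close>, hence at
    most a quarter, which leaves room for the factor 4.\<close>
  define R where "R = (\<lambda>i j. (4 / 2 ^ n) * (\<Sum>T\<in>I. r T i * r T j))"
  have "psd n R" unfolding R_def by (intro psd_scale psd_sum_outer I) simp
  moreover have "R i i \<le> (s i)\<^sup>2" if i: "i < n" for i
  proof (cases "s i = 0")
    \<comment> \<open>Here \<open>Y i i \<le> 0\<close>, so the second moment of \<open>w\<close> at
      \<open>i\<close>, and with it that of the remainder, is not positive.\<close>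
    case True
    have "(\<Sum>T\<in>I. r T i * r T i) \<le> (\<Sum>T\<in>I. w T i * w T i)"
      using clip_remainder(2)[OF s[OF i]]
      by (intro sum_mono) (simp add: r_def v_def power2_eq_square)
    also have "\<dots> = 2 ^ n * Y i i"
      unfolding I_def w_def rademacher_second_moment G[OF i i] ..
    also have "\<dots> \<le> 0" using diag[OF i] True by (simp add: mult_nonneg_nonpos)
    finally show ?thesis using True by (simp add: R_def divide_nonpos_pos)
  next
    case False
    have "(s i)\<^sup>2 * (\<Sum>T\<in>I. r T i * r T i) \<le> (\<Sum>T\<in>I. w T i ^ 4 / 16)"
      using clip_remainder(1)[OF s[OF i]] unfolding sum_distrib_left
      by (intro sum_mono) (simp add: r_def v_def power2_eq_square)
    also have "\<dots> \<le> 2 ^ n * (3 * (Y i i)\<^sup>2) / 16"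
      unfolding sum_divide_distrib[symmetric] I_def w_def
      using rademacher_fourth_moment[where d = n and a = "G i"] G[OF i i]
      by (intro divide_right_mono) (simp_all add: power2_eq_square)
    also have "\<dots> \<le> 2 ^ n * (4 * ((s i)\<^sup>2)\<^sup>2) / 16"
      using power_mono[OF diag[OF i] psd_diag_nonneg[OF Y i], of 2]
      by (intro divide_right_mono mult_left_mono mult_mono) auto
    finally have "(s i)\<^sup>2 * (\<Sum>T\<in>I. r T i * r T i) \<le> (s i)\<^sup>2 * (2 ^ n * (s i)\<^sup>2 / 4)"
      by (simp add: power2_eq_square mult_ac)
    then have "(\<Sum>T\<in>I. r T i * r T i) \<le> 2 ^ n * (s i)\<^sup>2 / 4"
      using False by (simp add: mult_le_cancel_left_pos)
    then show ?thesis by (simp add: R_def field_simps)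
  qed
  moreover have "pairing n A Y \<le> 2 * V + pairing n A R / 2"
  proof -
    have "2 ^ n * pairing n A Y = pairing n A (\<lambda>i j. \<Sum>T\<in>I. w T i * w T j)"
      unfolding pairing_def I_def w_def rademacher_second_moment sum_distrib_left[of "2 ^ n"]
      by (intro sum.cong refl) (simp add: G sum_distrib_left mult_ac)
    also have "\<dots> = (\<Sum>T\<in>I. quad n A (w T))" unfolding sum_quad_eq_pairing ..
    also have "\<dots> \<le> (\<Sum>T\<in>I. 2 * V + 2 * quad n A (r T))"
    proof (intro sum_mono)
      fix T
      have "quad n A (w T) = quad n A (\<lambda>i. v T i + r T i)" by (simp add: r_def)
      also have "\<dots> \<le> 2 * quad n A (v T) + 2 * quad n A (r T)" by (rule psd_add_le[OF A])
      also have "quad n A (v T) \<le> V"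
        by (rule V) (simp add: v_def clip_remainder(3)[OF s])
      finally show "quad n A (w T) \<le> 2 * V + 2 * quad n A (r T)" by simp
    qed
    also have "\<dots> = 2 ^ n * (2 * V) + 2 * pairing n A (\<lambda>i j. \<Sum>T\<in>I. r T i * r T j)"
      by (simp add: sum.distrib I sum_quad_eq_pairing flip: sum_distrib_left)
    also have "\<dots> = 2 ^ n * (2 * V + pairing n A R / 2)"
      unfolding R_def pairing_scale by (simp add: field_simps)
    finally show ?thesis by simp
  qed
  ultimately show ?thesis by blast
qed

text \<open>Instead of iterating the truncation, the step is applied under the supremum over all
  admissible \<open>Y\<close>: \<open>Sup S \<le> 2 * V + Sup S / 2\<close>, and finiteness of
  \<open>Sup S\<close> allows solving for it.\<close>

theorem little_grothendieck:
  assumes A: "psd n A" and Y: "psd n Y" and s: "\<And>i. i < n \<Longrightarrow> 0 \<le> s i"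
    and diag: "\<And>i. i < n \<Longrightarrow> Y i i \<le> (s i)\<^sup>2"
    and V: "\<And>z. (\<And>i. i < n \<Longrightarrow> \<bar>z i\<bar> \<le> s i) \<Longrightarrow> quad n A z \<le> V"
  shows "pairing n A Y \<le> 4 * V"
proof -
  define S where "S = {pairing n A Y | Y. psd n Y \<and> (\<forall>i<n. Y i i \<le> (s i)\<^sup>2)}"
  have "bdd_above S"
  proof (rule bdd_aboveI)
    fix x assume "x \<in> S"
    then obtain Y where Y: "psd n Y" "\<And>i. i < n \<Longrightarrow> Y i i \<le> (s i)\<^sup>2" "x = pairing n A Y"
      unfolding S_def by blast
    show "x \<le> (\<Sum>i<n. \<Sum>j<n. \<bar>A i j\<bar> * ((s i)\<^sup>2 + (s j)\<^sup>2))"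
      unfolding Y(3) pairing_def
    proof (intro sum_mono)
      fix i j assume "i \<in> {..<n}" "j \<in> {..<n}"
      then have "\<bar>Y i j\<bar> \<le> (s i)\<^sup>2 + (s j)\<^sup>2"
        using psd_entry_le[OF Y(1), of i j] Y(2)[of i] Y(2)[of j] by auto
      then have "\<bar>A i j * Y i j\<bar> \<le> \<bar>A i j\<bar> * ((s i)\<^sup>2 + (s j)\<^sup>2)"
        unfolding abs_mult by (rule mult_left_mono) simp
      then show "A i j * Y i j \<le> \<bar>A i j\<bar> * ((s i)\<^sup>2 + (s j)\<^sup>2)" by simp
    qed
  qed
  moreover have YS: "pairing n A Y \<in> S" using Y diag unfolding S_def by blast
  moreover have "Sup S \<le> 2 * V + Sup S / 2"
  proof (rule cSup_least)
    show "S \<noteq> {}" using YS by blast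
    fix x assume "x \<in> S"
    then obtain Y where Y: "psd n Y" "\<And>i. i < n \<Longrightarrow> Y i i \<le> (s i)\<^sup>2" "x = pairing n A Y"
      unfolding S_def by blast
    obtain R where R: "psd n R" "\<forall>i<n. R i i \<le> (s i)\<^sup>2" "x \<le> 2 * V + pairing n A R / 2"
      using little_grothendieck_step[OF A Y(1) s Y(2) V] Y(3) by auto
    have "pairing n A R \<le> Sup S"
      using R \<open>bdd_above S\<close> by (intro cSup_upper) (auto simp: S_def)
    then show "x \<le> 2 * V + Sup S / 2" using R(3) by simp
  qed
  ultimately have "pairing n A Y \<le> Sup S" "Sup S \<le> 4 * V"
    by (simp_all add: cSup_upper)
  then show ?thesis by simp
qed

section \<open>Vertices of the capped box\<close>

text \<open>Convexity: the value at a point of a segment is at most that at one of the ends, and the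
  sign of the first-order coefficient \<open>B\<close> tells which.\<close>

lemma quad_line:
  assumes "psd n A" "a \<ge> 0" "b \<ge> 0"
  shows "quad n A u \<le> quad n A (\<lambda>i. u i + b * d i) \<or> quad n A u \<le> quad n A (\<lambda>i. u i + (- a) * d i)"
proof -
  define B where "B = (\<Sum>i<n. \<Sum>j<n. A i j * (u i * d j + d i * u j))"
  have "quad n A (\<lambda>i. u i + t * d i) \<ge> quad n A u + t * B" for t
    using assms(1) unfolding quad_add_scaled B_def psd_def by simp
  from this[of b] this[of "- a"] show ?thesis
    using mult_nonneg_nonneg[of b B] mult_nonneg_nonneg[of a "- B"] assms(2,3)
    by (cases "B \<ge> 0") linarith+
qed

text \<open>Induction on the number of fractional coordinates. Two of them are moved in opposite
  directions, which preserves the sum, until one becomes 0 or 1; a single one is moved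
  alone.\<close>

lemma quad_round:
  assumes A: "psd n A"
    and "\<And>i. i < n \<Longrightarrow> 0 \<le> u i \<and> u i \<le> 1" and "(\<Sum>i<n. u i) \<le> real k"
  shows "\<exists>x. (\<forall>i<n. x i \<in> {0, 1}) \<and> (\<Sum>i<n. x i) \<le> real k \<and> quad n A u \<le> quad n A x"
  using assms(2,3)
proof (induction "card {i. i < n \<and> u i \<notin> {0, 1}}" arbitrary: u rule: less_induct)
  case less
  let ?frac = "\<lambda>u :: nat \<Rightarrow> real. {i. i < n \<and> u i \<notin> {0, 1}}"
  have improve: ?case
    if "\<And>i. i < n \<Longrightarrow> 0 \<le> y i \<and> y i \<le> 1" "(\<Sum>i<n. y i) \<le> real k"
      "?frac y \<subset> ?frac u" "quad n A u \<le> quad n A y" for y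
    using less.hyps[of y] that psubset_card_mono[OF _ that(3)] order_trans[OF that(4)] by auto
  consider "?frac u = {}" | i where "?frac u = {i}" | i j where "i \<in> ?frac u" "j \<in> ?frac u" "i \<noteq> j"
    by blast
  then show ?case
  proof cases
    case 1
    then show ?thesis using less.prems(2) by blast
  next
    case (2 i)
    then have i: "i < n" "0 < u i" "u i < 1" using less.prems(1)[of i] by (auto simp: less_le)
    \<comment> \<open>The other coordinates sum to an integer strictly below \<open>k\<close>, so
      there is room to raise the fractional one to 1.\<close>
    have int: "(\<Sum>l\<in>{..<n} - {i}. u l) \<in> \<int>"
    proof (rule Ints_sum)
      fix l assume "l \<in> {..<n} - {i}"
      then have "u l \<in> {0, 1}" using 2 by blast
      then show "u l \<in> \<int>" by auto
    qed
    have split: "(\<Sum>l<n. f l) = f i + (\<Sum>l\<in>{..<n} - {i}. f l)" for f :: "nat \<Rightarrow> real"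
      using i(1) by (intro sum.remove) auto
    have below: "(\<Sum>l\<in>{..<n} - {i}. u l) < real k"
      using less.prems(2) i split[of u] by simp
    then have room: "(\<Sum>l\<in>{..<n} - {i}. u l) + 1 \<le> real k"
    proof -
      obtain z where z: "(\<Sum>l\<in>{..<n} - {i}. u l) = of_int z" using int by (rule Ints_cases)
      then have "z < int k" using below by linarith
      then show ?thesis unfolding z by linarith
    qed
    define y where "y = (\<lambda>t l. u l + t * (if l = i then 1 else 0))"
    have y: "y t l = (if l = i then u i + t else u l)" for t l by (simp add: y_def)
    have "quad n A u \<le> quad n A (y (1 - u i)) \<or> quad n A u \<le> quad n A (y (- u i))"
      unfolding y_def by (rule quad_line[OF A]) (use i in auto)
    then obtain t where t: "quad n A u \<le> quad n A (y t)" "t = 1 - u i \<or> t = - u i" by blast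
    have "(\<Sum>l<n. y t l) = u i + t + (\<Sum>l\<in>{..<n} - {i}. u l)"
      unfolding split[of "y t"] by (simp add: y)
    then have "(\<Sum>l<n. y t l) \<le> real k" using room t(2) by linarith
    moreover have "y t i \<in> {0, 1}" using t(2) by (auto simp: y)
    moreover have "?frac (y t) \<subset> ?frac u"
    proof -
      have "l \<in> ?frac u" if "l \<in> ?frac (y t)" for l
        using that \<open>y t i \<in> {0, 1}\<close> by (cases "l = i") (simp_all add: y)
      moreover have "i \<in> ?frac u - ?frac (y t)" using 2 \<open>y t i \<in> {0, 1}\<close> by blast
      ultimately show ?thesis by blast
    qed
    moreover have "0 \<le> y t l \<and> y t l \<le> 1" if "l < n" for l
      using less.prems(1)[OF that] t(2) by (auto simp: y)
    ultimately show ?thesis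
      using t(1) by (intro improve[of "y t"])
  next
    case (3 i j)
    then have ij: "i < n" "j < n" "0 < u i" "u i < 1" "0 < u j" "u j < 1"
      using less.prems(1)[of i] less.prems(1)[of j] by (auto simp: less_le)
    define y where "y = (\<lambda>t l. u l + t * ((if l = i then 1 else 0) - (if l = j then 1 else 0)))"
    have y: "y t l = (if l = i then u i + t else if l = j then u j - t else u l)" for t l
      using 3(3) by (simp add: y_def)
    \<comment> \<open>The largest steps in the two directions that keep both coordinates in
      [0, 1].\<close>
    let ?a = "min (u i) (1 - u j)" and ?b = "min (1 - u i) (u j)"
    have "quad n A u \<le> quad n A (y ?b) \<or> quad n A u \<le> quad n A (y (- ?a))"
      unfolding y_def by (rule quad_line[OF A]) (use ij in auto)
    then obtain t where t: "quad n A u \<le> quad n A (y t)" "t = ?b \<or> t = - ?a" by blast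
    have "(\<Sum>l<n. y t l) = (\<Sum>l<n. u l)"
      using ij by (simp add: y_def sum.distrib sum_subtractf flip: sum_distrib_left)
    moreover have "y t i \<in> {0, 1} \<or> y t j \<in> {0, 1}"
    proof -
      have "t \<in> {1 - u i, u j, - u i, u j - 1}"
        using t(2) unfolding min_def by (cases "u i \<le> 1 - u j"; cases "1 - u i \<le> u j") auto
      then show ?thesis using 3(3) by (auto simp: y)
    qed
    then have "?frac (y t) \<subset> ?frac u"
    proof -
      have "l \<in> ?frac u" if "l \<in> ?frac (y t)" for l
        using that 3 by (cases "l = i \<or> l = j") (auto simp: y)
      moreover have "?frac (y t) \<noteq> ?frac u"
        using 3 \<open>y t i \<in> {0, 1} \<or> y t j \<in> {0, 1}\<close> by blast
      ultimately show ?thesis by blast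
    qed
    moreover have "0 \<le> y t l \<and> y t l \<le> 1" if "l < n" for l
    proof -
      have "0 \<le> u i + t" "u i + t \<le> 1" "0 \<le> u j - t" "u j - t \<le> 1"
        using t(2) ij by linarith+
      then show ?thesis using less.prems(1)[OF that] by (simp add: y)
    qed
    ultimately show ?thesis
      using t(1) less.prems(2) by (intro improve[of "y t"]) simp_all
  qed
qed

section \<open>The semidefinite relaxation\<close>

lemma scalar_prod_mult_mat_vec:
  assumes "X \<in> carrier_mat N N" "v \<in> carrier_vec N"
  shows "v \<bullet> (X *\<^sub>v v) = quad N (\<lambda>i j. X $$ (i, j)) (\<lambda>i. v $ i)"
proof -
  have "v \<bullet> (X *\<^sub>v v) = (\<Sum>i<N. v $ i * (row X i \<bullet> v))"
    using assms by (auto simp: scalar_prod_def[of v] atLeast0LessThan intro!: sum.cong)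
  also have "\<dots> = (\<Sum>i<N. \<Sum>j<N. v $ i * (X $$ (i, j) * v $ j))"
    using assms unfolding scalar_prod_def sum_distrib_left
    by (intro sum.cong refl) (auto simp: atLeast0LessThan)
  finally show ?thesis unfolding quad_def by (simp add: mult_ac)
qed

lemma quad_eq_scalar_prod:
  assumes "X \<in> carrier_mat N N"
  shows "quad N (\<lambda>i j. X $$ (i, j)) u = vec N u \<bullet> (X *\<^sub>v vec N u)"
  using scalar_prod_mult_mat_vec[OF assms, of "vec N u"] by (simp add: quad_def)

lemma pos_semidef_psd:
  assumes "X \<in> carrier_mat N N" "pos_semidef X"
  shows "psd N (\<lambda>i j. X $$ (i, j))"
  unfolding psd_def
proof (intro conjI allI impI)
  fix i j assume "i < N" "j < N"
  moreover have "transpose_mat X = X" using assms(2) by (simp add: pos_semidef_def)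
  ultimately show "X $$ (i, j) = X $$ (j, i)"
    using assms(1) by (metis carrier_matD index_transpose_mat(1))
next
  fix v
  show "0 \<le> quad N (\<lambda>i j. X $$ (i, j)) v"
    using assms unfolding quad_eq_scalar_prod[OF assms(1)] pos_semidef_def by auto
qed

lemma mat_trace_mult:
  assumes "A \<in> carrier_mat N N" "X \<in> carrier_mat N N" "pos_semidef X"
  shows "mat_trace (A * X) = pairing N (\<lambda>i j. A $$ (i, j)) (\<lambda>i j. X $$ (i, j))"
proof -
  have "X $$ (i, j) = X $$ (j, i)" if "i < N" "j < N" for i j
    using pos_semidef_psd[OF assms(2,3)] that unfolding psd_def by blast
  then show ?thesis
    using assms(1,2) unfolding mat_trace_def pairing_def
    by (auto simp: scalar_prod_def atLeast0LessThan intro!: sum.cong)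
qed

lemma lifted_gram_carrier:
  assumes "F \<in> carrier_mat n m"
  shows "lifted_gram F \<in> carrier_mat (2 * n) (2 * n)"
  using assms unfolding lifted_gram_def kronecker_def mat_of_rows_list_def by (auto simp: mult_2)

text \<open>\<open>H\<close> is \<open>F\<close> stacked on top of \<open>- F\<close>; the lifted
  matrix is its Gram matrix.\<close>

lemma lifted_gram_index:
  assumes F: "F \<in> carrier_mat n m" and ij: "i < 2 * n" "j < 2 * n"
  defines "H \<equiv> \<lambda>i c. if i < n then F $$ (i, c) else - F $$ (i - n, c)"
  shows "lifted_gram F $$ (i, j) = (\<Sum>c<m. H i c * H j c)"
proof -
  have dm: "l div n = (if l < n then 0 else 1)" "l mod n = (if l < n then l else l - n)"
    if "l < 2 * n" for l
    using that by (auto simp: le_div_geq le_mod_geq)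
  have "(F * transpose_mat F) $$ (a, b) = (\<Sum>c<m. F $$ (a, c) * F $$ (b, c))"
    if "a < n" "b < n" for a b
    using F that by (simp add: scalar_prod_def atLeast0LessThan)
  then show ?thesis
    using F ij unfolding lifted_gram_def kronecker_def mat_of_rows_list_def H_def
    by (auto simp: dm sum_negf)
qed

lemma sum_lessThan_double:
  fixes f :: "nat \<Rightarrow> 'a::comm_monoid_add"
  shows "(\<Sum>i<2 * n. f i) = (\<Sum>i<n. f i + f (n + i))"
proof -
  have "(\<Sum>i<2 * n. f i) = (\<Sum>i<n. f i) + (\<Sum>i\<in>{n..<n + n}. f i)"
    by (metis atLeast0LessThan le_add1 mult_2 sum.atLeastLessThan_concat zero_le)
  also have "(\<Sum>i\<in>{n..<n + n}. f i) = (\<Sum>i<n. f (n + i))"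
    using sum.shift_bounds_nat_ivl[of f 0 n n] by (simp add: atLeast0LessThan add.commute)
  finally show ?thesis by (simp add: sum.distrib)
qed

lemma quad_lifted_gram:
  assumes F: "F \<in> carrier_mat n m"
  shows "quad (2 * n) (\<lambda>i j. lifted_gram F $$ (i, j)) u =
    (\<Sum>c<m. (\<Sum>i<n. F $$ (i, c) * (u i - u (n + i)))\<^sup>2)"
proof -
  define H where "H i c = (if i < n then F $$ (i, c) else - F $$ (i - n, c))" for i c
  have "quad (2 * n) (\<lambda>i j. lifted_gram F $$ (i, j)) u =
      (\<Sum>i<2 * n. \<Sum>j<2 * n. \<Sum>c<m. (H i c * u i) * (H j c * u j))"
    unfolding quad_def using lifted_gram_index[OF F]
    by (intro sum.cong refl) (simp add: H_def sum_distrib_left sum_distrib_right mult.commute mult.left_commute)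
  also have "\<dots> = (\<Sum>c<m. (\<Sum>i<2 * n. H i c * u i)\<^sup>2)"
    unfolding power2_eq_square sum_product sum.swap[of _ "{..<m}"] ..
  also have "\<dots> = (\<Sum>c<m. (\<Sum>i<n. F $$ (i, c) * (u i - u (n + i)))\<^sup>2)"
    unfolding sum_lessThan_double by (simp add: H_def algebra_simps)
  finally show ?thesis .
qed

lemma psd_lifted_gram:
  assumes F: "F \<in> carrier_mat n m"
  shows "psd (2 * n) (\<lambda>i j. lifted_gram F $$ (i, j))"
  unfolding psd_def quad_lifted_gram[OF F]
  by (auto simp: lifted_gram_index[OF F] mult_ac intro!: sum_nonneg sum.cong)

text \<open>Rounding by \<open>quad_round\<close> yields a 0-1 vector that competes in the maximum
  defining \<open>sigma_sparse\<close>; the zero vector shows that this maximum is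
  nonnegative.\<close>

lemma quad_le_sigma_sparse:
  assumes F: "F \<in> carrier_mat n m"
    and u: "\<And>i. i < 2 * n \<Longrightarrow> 0 \<le> u i \<and> u i \<le> 1" and "(\<Sum>i<2 * n. u i) \<le> real j"
  shows "quad (2 * n) (\<lambda>i j. lifted_gram F $$ (i, j)) u \<le> (sigma_sparse j F)\<^sup>2"
    and "0 \<le> sigma_sparse j F"
proof -
  let ?N = "2 * n"
  let ?q = "quad ?N (\<lambda>i j. lifted_gram F $$ (i, j))"
  have M: "lifted_gram F \<in> carrier_mat ?N ?N" by (rule lifted_gram_carrier[OF F])
  define U where "U = {u. u \<in> carrier_vec ?N \<and> (\<forall>i<?N. u $ i \<in> {0, 1}) \<and>
    (\<Sum>i<?N. u $ i) \<le> real j}"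
  define S where "S = (\<lambda>u. u \<bullet> (lifted_gram F *\<^sub>v u)) ` U"
  have "U \<subseteq> vec ?N ` (PiE {..<?N} (\<lambda>_. {0, 1}))"
  proof
    fix u assume u: "u \<in> U"
    let ?r = "restrict (\<lambda>i. u $ i) {..<?N}"
    have "u = vec ?N ?r"
      using u by (intro eq_vecI) (auto simp: U_def)
    moreover have "?r \<in> PiE {..<?N} (\<lambda>_. {0, 1})"
      using u by (intro restrict_PiE_iff[THEN iffD2]) (auto simp: U_def)
    ultimately show "u \<in> vec ?N ` (PiE {..<?N} (\<lambda>_. {0, 1}))"
      by (metis imageI)
  qed
  then have fin: "finite S"
    unfolding S_def by (intro finite_imageI) (rule finite_subset, assumption, intro finite_imageI finite_PiE, auto)
  have mem: "?q x \<in> S" if "\<forall>i<?N. x i \<in> {0, 1}" "(\<Sum>i<?N. x i) \<le> real j" for x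
    unfolding quad_eq_scalar_prod[OF M] S_def U_def using that by (intro imageI) auto
  have sig: "sigma_sparse j F = sqrt (Max S)"
    using F unfolding sigma_sparse_def S_def U_def image_def by (intro arg_cong[of _ _ sqrt] arg_cong[of _ _ Max]) auto
  have "0 = ?q (\<lambda>_. 0)" by (simp add: quad_def)
  also have "\<dots> \<le> Max S" by (intro Max_ge fin mem) auto
  finally have "0 \<le> Max S" .
  then show "0 \<le> sigma_sparse j F" unfolding sig by simp
  obtain x where "\<forall>i<?N. x i \<in> {0, 1}" "(\<Sum>i<?N. x i) \<le> real j" "?q u \<le> ?q x"
    using quad_round[OF psd_lifted_gram[OF F] u assms(3)] by blast
  then show "?q u \<le> (sigma_sparse j F)\<^sup>2"
    using Max_ge[OF fin mem[of x]] \<open>0 \<le> Max S\<close> unfolding sig by simp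
qed

section \<open>Bounding the semidefinite program by the sparse maximum\<close>

text \<open>Cauchy-Schwarz against the all-ones vector, obtained from AM-GM on each pair of
  indices.\<close>

lemma sum_sqrt_le:
  assumes "\<And>i. i < N \<Longrightarrow> 0 \<le> a i"
  shows "(\<Sum>i<N. sqrt (a i))\<^sup>2 \<le> real N * (\<Sum>i<N. a i)"
proof -
  have "(\<Sum>i<N. sqrt (a i))\<^sup>2 = (\<Sum>i<N. \<Sum>j<N. sqrt (a i) * sqrt (a j))"
    by (simp add: power2_eq_square sum_product)
  also have "\<dots> \<le> (\<Sum>i<N. \<Sum>j<N. (a i + a j) / 2)"
    unfolding real_sqrt_mult[symmetric] using assms by (intro sum_mono arith_geo_mean_sqrt) auto
  also have "\<dots> = real N * (\<Sum>i<N. a i)"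
    by (simp add: sum.distrib flip: sum_divide_distrib sum_distrib_left)
  finally show ?thesis .
qed

text \<open>The 16 is the Grothendieck constant 4 times the 4 lost by halving \<open>z\<close>
  inside a quadratic form. The bound on \<open>k\<close> ensures that half of \<open>z\<close> has
  absolute sum at most \<open>j\<close>.\<close>

lemma sdp_objective_le:
  assumes F: "F \<in> carrier_mat n m" and X: "X \<in> sdp_feasible (2 * n) k"
    and k: "real n * real k \<le> 2 * (real j)\<^sup>2"
  shows "mat_trace (lifted_gram F * X) \<le> 16 * (sigma_sparse j F)\<^sup>2"
proof -
  let ?q = "quad (2 * n) (\<lambda>i j. lifted_gram F $$ (i, j))"
  have Xc: "X \<in> carrier_mat (2 * n) (2 * n)" "pos_semidef X" "mat_trace X = real k"
    and Xe: "\<And>i. i < 2 * n \<Longrightarrow> 0 \<le> X $$ (i, i) \<and> X $$ (i, i) \<le> 1"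
    using X unfolding sdp_feasible_def by auto
  define s where "s i = sqrt (X $$ (i, i))" for i
  have s: "0 \<le> s i" "s i \<le> 1" if "i < 2 * n" for i using Xe[OF that] by (auto simp: s_def)
  have "(\<Sum>i<2 * n. s i)\<^sup>2 \<le> real (2 * n) * (\<Sum>i<2 * n. X $$ (i, i))"
    unfolding s_def using Xe by (intro sum_sqrt_le) auto
  also have "\<dots> = 2 * (real n * real k)" using Xc(1,3) by (simp add: mat_trace_def)
  also have "\<dots> \<le> (2 * real j)\<^sup>2" using k unfolding power_mult_distrib by (simp add: mult.commute)
  finally have sum_s: "(\<Sum>i<2 * n. s i) \<le> 2 * real j" by (rule power2_le_imp_le) simp
  have "pairing (2 * n) (\<lambda>i j. lifted_gram F $$ (i, j)) (\<lambda>i j. X $$ (i, j)) \<le>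
      4 * (4 * (sigma_sparse j F)\<^sup>2)"
  proof (rule little_grothendieck[OF psd_lifted_gram[OF F] pos_semidef_psd[OF Xc(1,2)], of s])
    show "\<And>i. i < 2 * n \<Longrightarrow> 0 \<le> s i" by (rule s)
    show "\<And>i. i < 2 * n \<Longrightarrow> X $$ (i, i) \<le> (s i)\<^sup>2" using Xe by (simp add: s_def)
    fix z assume z: "\<And>i. i < 2 * n \<Longrightarrow> \<bar>z i\<bar> \<le> s i"
    \<comment> \<open>The form only sees the difference of the two halves, so negative entries of \<open>z\<close>
      can be moved to the opposite half.\<close>
    define u where "u i = (if i < n then (max 0 (z i) + max 0 (- z (n + i))) / 2
      else (max 0 (z i) + max 0 (- z (i - n))) / 2)" for i
    have "0 \<le> u i \<and> u i \<le> 1" if "i < 2 * n" for i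
    proof (cases "i < n")
      case True
      then show ?thesis
        using z[of i] z[of "n + i"] s(2)[of i] s(2)[of "n + i"] by (auto simp: u_def)
    next
      case False
      then show ?thesis
        using that z[of i] z[of "i - n"] s(2)[of i] s(2)[of "i - n"]
        by (simp add: u_def less_imp_diff_less)
    qed
    moreover have "(\<Sum>i<2 * n. u i) \<le> real j"
    proof -
      \<comment> \<open>The positive and negative part of each \<open>z i\<close> occur once each,
        in opposite halves of \<open>u\<close>.\<close>
      have "(\<Sum>i<2 * n. u i) = (\<Sum>i<2 * n. \<bar>z i\<bar> / 2)"
        unfolding sum_lessThan_double by (intro sum.cong refl) (auto simp: u_def max_def)
      also have "\<dots> \<le> (\<Sum>i<2 * n. s i / 2)" using z by (intro sum_mono) auto
      finally show ?thesis using sum_s by (simp flip: sum_divide_distrib)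
    qed
    ultimately have "?q u \<le> (sigma_sparse j F)\<^sup>2" by (rule quad_le_sigma_sparse[OF F])
    moreover have "?q z = 4 * ?q u"
    proof -
      have "z i - z (n + i) = 2 * (u i - u (n + i))" if "i < n" for i
        using that by (simp add: u_def max_def field_simps)
      then have "(\<Sum>i<n. F $$ (i, c) * (z i - z (n + i))) =
          2 * (\<Sum>i<n. F $$ (i, c) * (u i - u (n + i)))" for c
        unfolding sum_distrib_left by (intro sum.cong) auto
      then show ?thesis
        unfolding quad_lifted_gram[OF F] sum_distrib_left[of 4] by (simp only: power_mult_distrib) simp
    qed
    ultimately show "?q z \<le> 4 * (sigma_sparse j F)\<^sup>2" by simp
  qed
  then show ?thesis
    unfolding mat_trace_mult[OF lifted_gram_carrier[OF F] Xc(1,2)] by simp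
qed

text \<open>The witness is the multiple \<open>k / N\<close> of the identity; a supremum over a
  nonempty set can be bounded by \<open>cSUP_least\<close>.\<close>

lemma sdp_feasible_nonempty:
  assumes "k \<le> N" "N > 0"
  shows "sdp_feasible N k \<noteq> {}"
proof -
  let ?X = "(real k / real N) \<cdot>\<^sub>m 1\<^sub>m N"
  have "pos_semidef ?X"
    unfolding pos_semidef_def
  proof (intro conjI ballI)
    show "transpose_mat ?X = ?X" by (intro eq_matI) auto
    fix v :: "real vec" assume "v \<in> carrier_vec (dim_row ?X)"
    then have v: "v \<in> carrier_vec N" by simp
    have "?X *\<^sub>v v = (real k / real N) \<cdot>\<^sub>v v"
      using v by (intro eq_vecI) auto
    then have "v \<bullet> (?X *\<^sub>v v) = (real k / real N) * (v \<bullet> v)"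
      using v by simp
    also have "\<dots> \<ge> 0" by (simp add: scalar_prod_def sum_nonneg)
    finally show "0 \<le> v \<bullet> (?X *\<^sub>v v)" .
  qed auto
  then have "?X \<in> sdp_feasible N k"
    using assms unfolding sdp_feasible_def mat_trace_def by auto
  then show ?thesis by blast
qed

lemma sqrt_SDP_le:
  assumes F: "F \<in> carrier_mat n m" and "n > 0" "k \<le> n"
    and k: "real n * real k \<le> 2 * (real j)\<^sup>2"
  shows "sqrt (SDP k (lifted_gram F)) \<le> 4 * sigma_sparse j F"
proof -
  have "dim_row (lifted_gram F) = 2 * n" using lifted_gram_carrier[OF F] by simp
  then have "SDP k (lifted_gram F) \<le> 16 * (sigma_sparse j F)\<^sup>2"
    unfolding SDP_def using sdp_feasible_nonempty[of k "2 * n"] assms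
    by (intro cSUP_least sdp_objective_le[OF F]) auto
  also have "\<dots> = (4 * sigma_sparse j F)\<^sup>2" by (simp add: power_mult_distrib)
  finally show ?thesis
    using quad_le_sigma_sparse(2)[OF F, of "\<lambda>_. 0" j] by (intro real_le_lsqrt) auto
qed

section \<open>Comparison of the logarithmic factors\<close>

lemma ln_le_two_sqrt:
  assumes "y > 0"
  shows "ln y \<le> 2 * sqrt y"
proof -
  have "ln y = 2 * ln (sqrt y)" using assms by (simp add: ln_sqrt)
  also have "ln (sqrt y) \<le> sqrt y" using assms ln_le_minus_one[of "sqrt y"] by simp
  finally show ?thesis by simp
qed

text \<open>\<open>L\<close> stands for \<open>ln n\<close>. From
  \<open>n * k \<le> K\<^sup>2 / L\<close> the logarithmic term on the left is a small multiple of
  \<open>sqrt K\<close>, and \<open>L \<le> K\<close> makes \<beta> one as well. By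
  \<open>large\<close> they add up to at most \<open>sqrt K\<close>, which the right side exceeds
  because \<open>ln (2 * n / K) \<ge> 1 / 2\<close>.\<close>

lemma coefficient_le:
  fixes \<beta> g n k K L :: real
  assumes pos: "\<beta> > 0" "0 < g" "g < 1" "n > 0" "L \<ge> 1" "k \<ge> 1"
    and K: "K = g * n" and k: "k \<le> g * inverse L * K"
    and large: "4 * sqrt (6 / sqrt L) + 4 * \<beta> / sqrt L \<le> 1"
  shows "(sqrt (2 * k * ln (2 * n / k)) + \<beta>) * 4 \<le> sqrt (2 * K * ln (2 * n / K)) + \<beta>"
proof -
  have Kpos: "K > 0" using K pos by simp
  have kL: "k * L \<le> g * K" using k pos by (simp add: field_simps)
  then have "L \<le> g * K" using mult_right_mono[of 1 k L] pos by linarith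
  also have "g * K \<le> K" using pos Kpos by simp
  finally have LK: "L \<le> K" .
  have "k * ln (2 * n / k) \<le> 3 * K / sqrt L"
  proof -
    have "k * ln (2 * n / k) \<le> k * (2 * sqrt (2 * n / k))"
      using pos by (intro mult_left_mono ln_le_two_sqrt) auto
    also have "\<dots> = sqrt (8 * (n * k))"
    proof (rule real_sqrt_unique[symmetric])
      have "(k * (2 * sqrt (2 * n / k)))\<^sup>2 = k\<^sup>2 * 4 * (2 * n / k)"
        using pos by (simp add: power_mult_distrib)
      then show "(k * (2 * sqrt (2 * n / k)))\<^sup>2 = 8 * (n * k)"
        using pos by (simp add: power2_eq_square)
    qed (use pos in auto)
    also have "\<dots> \<le> sqrt ((3 * K / sqrt L)\<^sup>2)"
    proof (rule real_sqrt_le_mono)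
      have "n * (k * L) \<le> n * (g * K)" using kL pos by (intro mult_left_mono) auto
      then have "n * k * L \<le> K\<^sup>2" using K by (simp add: power2_eq_square mult_ac)
      then have "n * k \<le> K\<^sup>2 / L" using pos by (simp add: field_simps)
      \<comment> \<open>Rounding 8 up to 9 makes the bound a perfect square.\<close>
      then have "8 * (n * k) \<le> 9 * (K\<^sup>2 / L)"
        using pos divide_nonneg_nonneg[of "K\<^sup>2" L] zero_le_power2[of K] by linarith
      also have "\<dots> = (3 * K / sqrt L)\<^sup>2"
        using pos by (simp add: power_divide power_mult_distrib)
      finally show "8 * (n * k) \<le> (3 * K / sqrt L)\<^sup>2" .
    qed
    also have "\<dots> = 3 * K / sqrt L" using pos Kpos by simp
    finally show ?thesis .
  qed
  then have "sqrt (2 * k * ln (2 * n / k)) \<le> sqrt (6 / sqrt L * K)"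
    using mult_left_mono[of "k * ln (2 * n / k)" "3 * K / sqrt L" 2]
    by (intro real_sqrt_le_mono) (simp add: mult.assoc)
  also have "\<dots> = sqrt (6 / sqrt L) * sqrt K" by (rule real_sqrt_mult)
  finally have 1: "4 * sqrt (2 * k * ln (2 * n / k)) \<le> 4 * sqrt (6 / sqrt L) * sqrt K" by simp
  have "4 * \<beta> * sqrt L \<le> 4 * \<beta> * sqrt K" using LK pos by (intro mult_left_mono) auto
  then have 2: "4 * \<beta> \<le> 4 * \<beta> / sqrt L * sqrt K" using pos by (simp add: field_simps)
  have "(4 * sqrt (6 / sqrt L) + 4 * \<beta> / sqrt L) * sqrt K \<le> 1 * sqrt K"
    using large Kpos by (intro mult_right_mono) auto
  then have "4 * sqrt (2 * k * ln (2 * n / k)) + 4 * \<beta> \<le> sqrt K"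
    using 1 2 by (simp add: distrib_right)
  also have "sqrt K \<le> sqrt (2 * K * ln (2 * n / K))"
  proof (rule real_sqrt_le_mono)
    have "1 / 2 \<le> ln (2::real)" using ln_le_minus_one[of "1/2::real"] by (simp add: ln_div)
    also have "\<dots> \<le> ln (2 * n / K)" using pos K Kpos by (intro ln_mono) (auto simp: field_simps)
    finally have "2 * K * (1 / 2) \<le> 2 * K * ln (2 * n / K)"
      using Kpos by (intro mult_left_mono) auto
    then show "K \<le> 2 * K * ln (2 * n / K)" by simp
  qed
  finally show ?thesis using pos by (simp add: algebra_simps)
qed

text \<open>Both terms vanish in the limit; the threshold depends on \<beta> alone and so is uniform
  in \<open>k\<close>.\<close>

lemma eventually_large:
  fixes \<beta> :: real
  shows "\<forall>\<^sub>F n::nat in sequentially.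
    4 * sqrt (6 / sqrt (ln (real n))) + 4 * \<beta> / sqrt (ln (real n)) \<le> 1"
proof -
  have L: "filterlim (\<lambda>n. sqrt (ln (real n))) at_top sequentially"
    by (intro filterlim_compose[OF sqrt_at_top] filterlim_compose[OF ln_at_top]
        filterlim_real_sequentially)
  have "(\<lambda>n. 4 * sqrt (6 / sqrt (ln (real n))) + 4 * \<beta> / sqrt (ln (real n)))
      \<longlonglongrightarrow> 4 * sqrt 0 + 0"
    by (intro tendsto_intros tendsto_divide_0[OF tendsto_const] filterlim_at_top_imp_at_infinity L)
  then have "\<forall>\<^sub>F n in sequentially.
      4 * sqrt (6 / sqrt (ln (real n))) + 4 * \<beta> / sqrt (ln (real n)) < 1"
    by (rule order_tendstoD) simp
  then show ?thesis by (rule eventually_mono) simp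
qed

section \<open>Assembly of the asymptotic statement\<close>

theorem proposition6p1:
  fixes \<beta> :: real
    and m kstar :: "nat \<Rightarrow> nat"
    and F :: "nat \<Rightarrow> real mat"
    and \<gamma> \<alpha> :: "nat \<Rightarrow> real"
  assumes "\<beta> > 0"
    and "\<And>n. n \<ge> 2 \<Longrightarrow> F n \<in> carrier_mat n (m n)"
    and "\<And>n. n \<ge> 2 \<Longrightarrow> 0 < \<gamma> n \<and> \<gamma> n < 1"
    and "\<And>n. n \<ge> 2 \<Longrightarrow> real (kstar n) = \<gamma> n * real n"
    and "\<And>n. n \<ge> 2 \<Longrightarrow> 0 \<le> \<alpha> n \<and> \<alpha> n \<le> 1"
    and "\<And>n. n \<ge> 2 \<Longrightarrow>
      (sqrt (2 * real (kstar n) * ln (2 * real n / real (kstar n))) + \<beta>) * sigma_sparse (kstar n) (F n)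
      \<le> (sqrt (2 / pi) * (\<Sum>i < n. row_norm (F n) i) - \<beta> * L_sign (F n)) * \<alpha> n"
  shows "\<forall>\<^sub>F n in sequentially. \<forall>k :: nat.
      1 \<le> k \<and> real k \<le> \<gamma> n * inverse (ln (real n)) * real (kstar n) \<longrightarrow>
      (sqrt (2 * real k * ln (2 * real n / real k)) + \<beta>) * sqrt (SDP k (lifted_gram (F n)))
      \<le> (sqrt (2 / pi) * (\<Sum>i < n. row_norm (F n) i) - \<beta> * L_sign (F n)) * \<alpha> n"
proof -
  have "\<forall>\<^sub>F n in sequentially. 1 \<le> ln (real n)"
    using filterlim_compose[OF ln_at_top filterlim_real_sequentially]
    unfolding filterlim_at_top by blast
  with eventually_large[of \<beta>] eventually_ge_at_top[of 2] show ?thesis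
  proof eventually_elim
    case (elim n)
    let ?rhs = "(sqrt (2 / pi) * (\<Sum>i<n. row_norm (F n) i) - \<beta> * L_sign (F n)) * \<alpha> n"
    show ?case
    proof (intro allI impI, elim conjE)
      fix k :: nat
      assume k: "1 \<le> k" "real k \<le> \<gamma> n * inverse (ln (real n)) * real (kstar n)"
      note F = assms(2)[OF elim(2)] and g = assms(3)[OF elim(2)] and K = assms(4)[OF elim(2)]
      \<comment> \<open>Here only \<open>ln n \<ge> 1\<close> is used; the gain of the full
        logarithm enters through \<open>coefficient_le\<close>.\<close>
      have "real k * ln (real n) \<le> \<gamma> n * real (kstar n)"
        using k(2) elim(3) by (simp add: field_simps)
      moreover have "real k * 1 \<le> real k * ln (real n)" using elim(3) by (intro mult_left_mono) auto
      ultimately have kK: "real k \<le> \<gamma> n * real (kstar n)" by simp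
      also have "\<dots> \<le> 1 * real (kstar n)" using g by (intro mult_right_mono) auto
      also have "real (kstar n) \<le> 1 * real n" unfolding K using g by (intro mult_right_mono) auto
      finally have "k \<le> n" by simp
      have "real n * real k \<le> real n * (\<gamma> n * real (kstar n))"
        using kK by (intro mult_left_mono) auto
      also have "\<dots> = (real (kstar n))\<^sup>2" using K by (simp add: power2_eq_square)
      also have "\<dots> \<le> 2 * (real (kstar n))\<^sup>2" by simp
      finally have SDP: "sqrt (SDP k (lifted_gram (F n))) \<le> 4 * sigma_sparse (kstar n) (F n)"
        using \<open>k \<le> n\<close> elim(2) by (intro sqrt_SDP_le[OF F]) auto
      \<comment> \<open>\<open>sqrt\<close> is negative at negative arguments, so the sign of the
        logarithm matters.\<close>
      have "1 \<le> 2 * real n / real k" using k(1) \<open>k \<le> n\<close> by (simp add: field_simps)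
      then have "0 \<le> sqrt (2 * real k * ln (2 * real n / real k)) + \<beta>"
        using assms(1) by (intro add_nonneg_nonneg) auto
      then have "(sqrt (2 * real k * ln (2 * real n / real k)) + \<beta>) * sqrt (SDP k (lifted_gram (F n)))
          \<le> (sqrt (2 * real k * ln (2 * real n / real k)) + \<beta>) * (4 * sigma_sparse (kstar n) (F n))"
        by (intro mult_left_mono SDP)
      \<comment> \<open>The factor 4 passes from the sparse maximum to the coefficient, where it is
        absorbed.\<close>
      also have "\<dots> = (sqrt (2 * real k * ln (2 * real n / real k)) + \<beta>) * 4 *
          sigma_sparse (kstar n) (F n)" by simp
      also have "\<dots> \<le> (sqrt (2 * real (kstar n) * ln (2 * real n / real (kstar n))) + \<beta>) *
          sigma_sparse (kstar n) (F n)"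
      proof (rule mult_right_mono)
        show "(sqrt (2 * real k * ln (2 * real n / real k)) + \<beta>) * 4 \<le>
            sqrt (2 * real (kstar n) * ln (2 * real n / real (kstar n))) + \<beta>"
          by (rule coefficient_le[OF assms(1) _ _ _ elim(3) _ K k(2) elim(1)])
            (use g k(1) elim(2) in simp_all)
      qed (rule quad_le_sigma_sparse(2)[OF F, of "\<lambda>_. 0"], simp_all)
      also have "\<dots> \<le> ?rhs" by (rule assms(6)[OF elim(2)])
      finally show "(sqrt (2 * real k * ln (2 * real n / real k)) + \<beta>) *
          sqrt (SDP k (lifted_gram (F n))) \<le> ?rhs" .
    qed
  qed
qed

end
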